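(* Let $D$ be a finite set with $|D|\ge 2$, let $\mathbb{P}_0=(p_{0s})_{s\in D}$ be a probability measure on $D$ with $p_{0s}>0$ for all $s\in D$, and let $c\ge 1$ satisfy $c<\min_{s\in D}\frac{1}{1-p_{0s}}$. Let $u$ be a strictly concave utility function, let $W=(W_s)_{s\in D}$ be a random wealth with values in the domain of $u$, and let $\alpha\in[0,1]$. Let $\underline{P}=(\underline p_s)_{s\in D}$ denote the minimizer and $\overline{P}=(\overline p_s)_{s\in D}$ the maximizer of $P\mapsto\mathbb{E}_P[u(W)]$ over $P\in\mathcal{X}$. Then for all $s\in D$, $$\underline{p}_s=p_{0s}\left(1+\frac{\mathbb{E}_0[u(W)]-u(W_s)}{\mathbb{S}_0[u(W)]}\sqrt{c-1}\right),\qquad \overline{p}_s=p_{0s}\left(1-\frac{\mathbb{E}_0[u(W)]-u(W_s)}{\mathbb{S}_0[u(W)]}\sqrt{c-1}\right).$$ In particular, $$V_\alpha(W)=\mathbb{E}_0[u(W)]-\sqrt{c-1}\,(2\alpha-1)\,\mathbb{S}_0[u(W)].$$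
   Context: $\mathbb{E}_0$ and $\mathbb{S}_0$ denote expectation and standard deviation under $\mathbb{P}_0$. The set of priors is $$\mathcal{X}=\Big\{P: P(s)\ge 0\ \forall s\in D,\ \sum_{s\in D}P(s)=1,\ \sum_{s\in D}\frac{P(s)^2}{p_{0s}}\le c\Big\}.$$ The $\alpha$-MEU value of $W$ is $$V_\alpha(W)=\alpha\min_{P\in\mathcal{X}}\mathbb{E}_P[u(W)]+(1-\alpha)\max_{P\in\mathcal{X}}\mathbb{E}_P[u(W)].$$ Convention: when $u(W)$ is constant (so that $\mathbb{S}_0[u(W)]=0$ and every $P\in\mathcal X$ is optimal) one takes $\underline p_s=\overline p_s=p_{0s}$. *)

theory Defs
  imports "HOL-Probability.Probability"
begin

definition strictly_concave_on :: "real set \<Rightarrow> (real \<Rightarrow> real) \<Rightarrow> bool" where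
  "strictly_concave_on I u \<longleftrightarrow> convex I \<and>
     (\<forall>x\<in>I. \<forall>y\<in>I. \<forall>t. x \<noteq> y \<longrightarrow> 0 < t \<longrightarrow> t < 1 \<longrightarrow>
        (1 - t) * u x + t * u y < u ((1 - t) * x + t * y))"

(* Nonnegativity and total mass 1 are part of the type pmf; together with
   set_pmf P \<subseteq> D they say that P is a probability vector on D. *)
definition prior_set :: "'s set \<Rightarrow> 's pmf \<Rightarrow> real \<Rightarrow> 's pmf set" where
  "prior_set D p0 c = {P. set_pmf P \<subseteq> D \<and> (\<Sum>s\<in>D. (pmf P s)\<^sup>2 / pmf p0 s) \<le> c}"

definition std_dev :: "'s pmf \<Rightarrow> ('s \<Rightarrow> real) \<Rightarrow> real" where
  "std_dev p X = sqrt (measure_pmf.variance p X)"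

(* If X is constant on D then every prior is optimal, and p0 is selected by convention. *)
definition is_minimizing_prior ::
  "'s set \<Rightarrow> 's pmf \<Rightarrow> real \<Rightarrow> ('s \<Rightarrow> real) \<Rightarrow> 's pmf \<Rightarrow> bool" where
  "is_minimizing_prior D p0 c X P \<longleftrightarrow>
     is_arg_min (\<lambda>Q. measure_pmf.expectation Q X) (\<lambda>Q. Q \<in> prior_set D p0 c) P \<and>
     (X constant_on D \<longrightarrow> P = p0)"

definition is_maximizing_prior ::
  "'s set \<Rightarrow> 's pmf \<Rightarrow> real \<Rightarrow> ('s \<Rightarrow> real) \<Rightarrow> 's pmf \<Rightarrow> bool" where
  "is_maximizing_prior D p0 c X P \<longleftrightarrow>
     is_arg_max (\<lambda>Q. measure_pmf.expectation Q X) (\<lambda>Q. Q \<in> prior_set D p0 c) P \<and>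
     (X constant_on D \<longrightarrow> P = p0)"

(* The minimum and maximum are rendered as INF and SUP; both are attained as soon as a
   minimizing and a maximizing prior exist. *)
definition alpha_MEU ::
  "'s set \<Rightarrow> 's pmf \<Rightarrow> real \<Rightarrow> (real \<Rightarrow> real) \<Rightarrow> real \<Rightarrow> ('s \<Rightarrow> real) \<Rightarrow> real" where
  "alpha_MEU D p0 c u \<alpha> W =
     \<alpha> * (INF P\<in>prior_set D p0 c. measure_pmf.expectation P (\<lambda>s. u (W s))) +
     (1 - \<alpha>) * (SUP P\<in>prior_set D p0 c. measure_pmf.expectation P (\<lambda>s. u (W s)))"

end

theory Submission
  imports Defs
begin

text \<open>
  Write \<open>X = u(W)\<close>, \<open>m\<close> and \<open>\<sigma>\<close> for its mean and standard deviation under \<open>p0\<close>, and \<open>r = sqrt (c - 1)\<close>.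
  The set of priors is the chi-square ball \<open>\<Sum>s. (P s - p0 s)^2 / p0 s \<le> r^2\<close>, and the candidate
  maximizer is \<open>Q s = p0 s * (1 + (X s - m) / \<sigma> * r)\<close>, at chi-square distance exactly \<open>r^2\<close>
  (if \<open>\<sigma> = 0\<close>, division by zero makes \<open>Q = p0\<close>, as the convention asks).
  Expanding the square gives
  \<open>\<Sum>s. (P s - Q s)^2 / p0 s \<le> 2 * r / \<sigma> * (m + r * \<sigma> - E_P X)\<close> for every prior \<open>P\<close> when \<open>\<sigma> > 0\<close>, which yields
  both the optimality of \<open>Q\<close> and its uniqueness. Nonnegativity of \<open>Q\<close> is where the upper bound
  on \<open>c\<close> enters, through the inequality \<open>p0 s * (X s - m)^2 \<le> (1 - p0 s) * \<sigma>^2\<close>. Minimizing \<open>X\<close>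
  is maximizing \<open>-X\<close>.
\<close>

section \<open>Mean and variance on a finite support\<close>

lemma expectation_pmf_sum:
  fixes f :: "'s \<Rightarrow> real"
  assumes "finite D" "set_pmf P \<subseteq> D"
  shows "measure_pmf.expectation P f = (\<Sum>s\<in>D. pmf P s * f s)"
  using assms by (subst integral_measure_pmf_real[where A = D]) (auto simp: mult.commute)

lemma std_dev_nonneg: "0 \<le> std_dev p X"
  unfolding std_dev_def by (simp add: integral_nonneg_AE)

lemma std_dev_square: "(std_dev p X)\<^sup>2 = measure_pmf.variance p X"
  unfolding std_dev_def by (simp add: integral_nonneg_AE)

lemma std_dev_uminus: "std_dev p (\<lambda>s. - X s) = std_dev p X"
  unfolding std_dev_def by (simp add: power2_commute)

lemma sum_centered_eq_0:
  fixes X :: "'s \<Rightarrow> real"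
  assumes "finite D" "set_pmf p \<subseteq> D"
  shows "(\<Sum>s\<in>D. pmf p s * (X s - measure_pmf.expectation p X)) = 0"
  using assms by (simp add: expectation_pmf_sum sum_pmf_eq_1 right_diff_distrib sum_subtractf
      flip: sum_distrib_right)

text \<open>With full support, a vanishing weighted sum of squares vanishes pointwise. This ties the
  convention for constant \<open>X\<close> to the case of zero standard deviation.\<close>

lemma std_dev_eq_0_iff_constant:
  assumes "finite D" "set_pmf p = D"
  shows "std_dev p X = 0 \<longleftrightarrow> X constant_on D"
proof
  let ?m = "measure_pmf.expectation p X"
  assume "std_dev p X = 0"
  then have "(\<Sum>s\<in>D. pmf p s * (X s - ?m)\<^sup>2) = 0"
    using assms std_dev_square[of p X] by (simp add: expectation_pmf_sum[where D = D])
  then have "\<forall>s\<in>D. pmf p s * (X s - ?m)\<^sup>2 = 0"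
    using assms by (subst (asm) sum_nonneg_eq_0_iff) auto
  then have "\<forall>s\<in>D. X s = ?m"
    using assms by (auto simp: set_pmf_iff)
  then show "X constant_on D"
    unfolding constant_on_def by blast
next
  assume "X constant_on D"
  then obtain k where k: "\<forall>s\<in>D. X s = k"
    unfolding constant_on_def by blast
  then have "measure_pmf.expectation p X = k"
    using assms by (simp add: expectation_pmf_sum[where D = D] sum_pmf_eq_1 flip: sum_distrib_right)
  then have "(std_dev p X)\<^sup>2 = 0"
    using assms k by (simp add: std_dev_square expectation_pmf_sum[where D = D])
  then show "std_dev p X = 0"
    by simp
qed

text \<open>Expand the sum over \<open>t \<noteq> s\<close> of \<open>pmf p t * (X t - m + a)^2\<close> with
  \<open>a = pmf p s * (X s - m) / (1 - pmf p s)\<close>, the negated mean of \<open>X - m\<close> off \<open>s\<close>.\<close>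
lemma deviation_le_variance:
  fixes X :: "'s \<Rightarrow> real"
  assumes fin: "finite D" and D: "set_pmf p \<subseteq> D" and s: "s \<in> D" and lt: "pmf p s < 1"
  shows "pmf p s * (X s - measure_pmf.expectation p X)\<^sup>2 \<le> (1 - pmf p s) * (std_dev p X)\<^sup>2"
proof -
  define Y where "Y = (\<lambda>t. X t - measure_pmf.expectation p X)"
  define q where "q = pmf p s"
  define a where "a = q * Y s / (1 - q)"
  have q: "1 - q > 0" "1 - q \<noteq> 0" "q \<ge> 0"
    using lt by (auto simp: q_def)
  have mass: "(\<Sum>t\<in>D - {s}. pmf p t) = 1 - q"
    using fin D s by (simp add: sum_diff1 sum_pmf_eq_1 q_def)
  have mean: "(\<Sum>t\<in>D - {s}. pmf p t * Y t) = - q * Y s"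
    using fin s sum_centered_eq_0[OF fin D, of X] by (simp add: sum_diff1 q_def Y_def)
  have var: "(\<Sum>t\<in>D - {s}. pmf p t * (Y t)\<^sup>2) = (std_dev p X)\<^sup>2 - q * (Y s)\<^sup>2"
    using fin D s by (simp add: sum_diff1 q_def Y_def std_dev_square expectation_pmf_sum)
  have "0 \<le> (\<Sum>t\<in>D - {s}. pmf p t * (Y t + a)\<^sup>2)"
    by (intro sum_nonneg) auto
  also have "\<dots> = (\<Sum>t\<in>D - {s}. pmf p t * (Y t)\<^sup>2) + 2 * a * (\<Sum>t\<in>D - {s}. pmf p t * Y t)
      + a\<^sup>2 * (\<Sum>t\<in>D - {s}. pmf p t)"
    by (simp add: power2_sum sum_distrib_left sum.distrib algebra_simps)
  finally have "0 \<le> (std_dev p X)\<^sup>2 - q * (Y s)\<^sup>2 - 2 * a * (q * Y s) + a * (a * (1 - q))"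
    unfolding mass mean var by (simp add: power2_eq_square mult.assoc)
  moreover have "a * (1 - q) = q * Y s"
    using q by (simp add: a_def)
  ultimately have "0 \<le> (std_dev p X)\<^sup>2 - q * (Y s)\<^sup>2 - a * (q * Y s)"
    by simp
  \<comment> \<open>Multiplying by \<open>1 - q\<close> clears the denominator of \<open>a\<close>;
    the weights \<open>1 - q\<close> and \<open>q\<close> on \<open>q * (Y s)^2\<close> then add up
    to 1.\<close>
  then have "0 \<le> (1 - q) * ((std_dev p X)\<^sup>2 - q * (Y s)\<^sup>2 - a * (q * Y s))"
    using q by simp
  also have "\<dots> = (1 - q) * (std_dev p X)\<^sup>2 - (1 - q) * (q * (Y s)\<^sup>2) - a * (1 - q) * (q * Y s)"
    by (simp add: algebra_simps)
  also have "\<dots> = (1 - q) * (std_dev p X)\<^sup>2 - q * (Y s)\<^sup>2"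
    unfolding \<open>a * (1 - q) = q * Y s\<close> by (simp add: algebra_simps power2_eq_square)
  finally show ?thesis
    by (simp add: q_def Y_def)
qed

section \<open>The chi-square ball and the tilted candidate\<close>

text \<open>Both measures have mass 1, so the linear terms of the expanded square sum to -1. The
  constraint with bound \<open>c\<close> thus describes a ball around \<open>p\<close> of squared
  radius \<open>c - 1\<close>.\<close>

lemma chi_square_eq:
  assumes "finite D" "set_pmf p = D" "set_pmf P \<subseteq> D"
  shows "(\<Sum>s\<in>D. (pmf P s - pmf p s)\<^sup>2 / pmf p s) = (\<Sum>s\<in>D. (pmf P s)\<^sup>2 / pmf p s) - 1"
proof -
  have "(pmf P s - pmf p s)\<^sup>2 / pmf p s = (pmf P s)\<^sup>2 / pmf p s - 2 * pmf P s + pmf p s"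
    if "s \<in> D" for s
    using assms(2) pmf_positive[of s p] that
    by (simp add: power2_eq_square algebra_simps add_divide_distrib diff_divide_distrib)
  then have "(\<Sum>s\<in>D. (pmf P s - pmf p s)\<^sup>2 / pmf p s)
      = (\<Sum>s\<in>D. (pmf P s)\<^sup>2 / pmf p s) - 2 * (\<Sum>s\<in>D. pmf P s) + (\<Sum>s\<in>D. pmf p s)"
    by (simp add: sum.distrib sum_subtractf sum_distrib_left)
  then show ?thesis
    using assms by (simp add: sum_pmf_eq_1)
qed

lemma ex_tilted_pmf:
  fixes X :: "'s \<Rightarrow> real"
  assumes fin: "finite D" and D: "set_pmf p = D"
    and c: "1 \<le> c" and bound: "\<And>s. s \<in> D \<Longrightarrow> pmf p s < 1 \<and> c \<le> 1 / (1 - pmf p s)"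
  obtains Q where "set_pmf Q \<subseteq> D"
    and "\<And>s. s \<in> D \<Longrightarrow> pmf Q s = pmf p s *
      (1 + (X s - measure_pmf.expectation p X) / std_dev p X * sqrt (c - 1))"
proof -
  define Y where "Y = (\<lambda>s. X s - measure_pmf.expectation p X)"
  define f where "f = (\<lambda>s. pmf p s * (1 + Y s / std_dev p X * sqrt (c - 1)))"
  have out: "f s = 0" if "s \<notin> D" for s
    using that D by (auto simp: f_def set_pmf_iff)
  have *: "- (Y s / std_dev p X * sqrt (c - 1)) \<le> 1" if s: "s \<in> D" for s
  proof (cases "std_dev p X = 0")
    case False
    then have sd: "std_dev p X > 0"
      using std_dev_nonneg[of p X] by simp
    have p: "0 < pmf p s" "pmf p s < 1"
      using bound s D by (auto simp: pmf_positive)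
    \<comment> \<open>This form of the bound on \<open>c\<close> trades the factor
      \<open>1 - pmf p s\<close> of \<open>deviation_le_variance\<close> for \<open>pmf p s\<close>,
      which then cancels.\<close>
    have "(c - 1) * (1 - pmf p s) \<le> pmf p s"
      using bound[OF s] p by (simp add: field_simps)
    moreover have "pmf p s * (Y s)\<^sup>2 \<le> (1 - pmf p s) * (std_dev p X)\<^sup>2"
      using deviation_le_variance[of D p s X] fin D s p by (simp add: Y_def)
    ultimately have "(c - 1) * (pmf p s * (Y s)\<^sup>2) \<le> pmf p s * (std_dev p X)\<^sup>2"
      using c mult_left_mono[of "pmf p s * (Y s)\<^sup>2" "(1 - pmf p s) * (std_dev p X)\<^sup>2" "c - 1"]
        mult_right_mono[of "(c - 1) * (1 - pmf p s)" "pmf p s" "(std_dev p X)\<^sup>2"]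
      by (simp add: mult.assoc)
    then have "(c - 1) * (Y s)\<^sup>2 \<le> (std_dev p X)\<^sup>2"
      using p by (simp add: mult.left_commute)
    then have "(Y s / std_dev p X * sqrt (c - 1))\<^sup>2 \<le> 1"
      using sd c by (simp add: power_mult_distrib power_divide field_simps)
    then show ?thesis
      by (simp only: abs_square_le_1 abs_le_iff)
  qed simp
  have nonneg: "0 \<le> f s" for s
  proof (cases "s \<in> D")
    case True
    then have "0 \<le> 1 + Y s / std_dev p X * sqrt (c - 1)"
      using *[of s] by linarith
    then show ?thesis
      by (simp add: f_def)
  qed (simp add: out)
  have "(\<Sum>s\<in>D. f s) = (\<Sum>s\<in>D. pmf p s) + (\<Sum>s\<in>D. pmf p s * Y s) / std_dev p X * sqrt (c - 1)"
    by (simp add: f_def ring_distribs sum.distrib sum_divide_distrib sum_distrib_right mult.assoc)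
  then have total: "(\<Sum>s\<in>D. f s) = 1"
    using fin D sum_centered_eq_0[of D p X] by (simp add: sum_pmf_eq_1 Y_def)
  \<comment> \<open>\<open>embed_pmf\<close> requires mass 1 over the whole type; since
    \<open>f\<close> vanishes off \<open>D\<close>, this is \<open>total\<close>.\<close>
  have "(\<integral>\<^sup>+s. ennreal (f s) \<partial>count_space UNIV) = (\<integral>\<^sup>+s. ennreal (f s) \<partial>count_space D)"
    using out by (intro nn_integral_count_space_eq) auto
  also have "\<dots> = 1"
    using fin nonneg total by (simp add: nn_integral_count_space_finite sum_ennreal)
  finally have pmf: "pmf (embed_pmf f) s = f s" for s
    using nonneg by (simp add: pmf_embed_pmf)
  show ?thesis
  proof
    show "set_pmf (embed_pmf f) \<subseteq> D"
      using out pmf by (metis set_pmf_iff subsetI)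
  qed (simp only: pmf, simp only: f_def Y_def)
qed

section \<open>Optimality and uniqueness of the candidate\<close>

lemma ex_optimal_prior:
  fixes X :: "'s \<Rightarrow> real"
  assumes fin: "finite D" and D: "set_pmf p = D"
    and c: "1 \<le> c" and bound: "\<And>s. s \<in> D \<Longrightarrow> pmf p s < 1 \<and> c \<le> 1 / (1 - pmf p s)"
  obtains Q where "Q \<in> prior_set D p c"
    and "\<And>s. s \<in> D \<Longrightarrow> pmf Q s = pmf p s *
      (1 + (X s - measure_pmf.expectation p X) / std_dev p X * sqrt (c - 1))"
    and "measure_pmf.expectation Q X = measure_pmf.expectation p X + sqrt (c - 1) * std_dev p X"
    and "\<And>P. P \<in> prior_set D p c \<Longrightarrow> measure_pmf.expectation P X \<le> measure_pmf.expectation Q X"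
    and "\<And>P. is_maximizing_prior D p c X P \<longleftrightarrow> P = Q"
proof -
  obtain Q where Q: "set_pmf Q \<subseteq> D"
    and Qs: "\<And>s. s \<in> D \<Longrightarrow> pmf Q s = pmf p s *
      (1 + (X s - measure_pmf.expectation p X) / std_dev p X * sqrt (c - 1))"
    using ex_tilted_pmf[OF fin D c bound] by blast
  define m where "m = measure_pmf.expectation p X"
  define \<sigma> where "\<sigma> = std_dev p X"
  define r where "r = sqrt (c - 1)"
  have r: "r \<ge> 0" "r\<^sup>2 = c - 1" and \<sigma>: "\<sigma> \<ge> 0"
    using c by (auto simp: r_def \<sigma>_def std_dev_nonneg)
  have pos: "pmf p s > 0" if "s \<in> D" for s
    using that D by (simp add: pmf_positive)
  have Q_diff: "pmf Q s - pmf p s = pmf p s * (X s - m) * (r / \<sigma>)" if "s \<in> D" for s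
    using Qs[OF that] by (simp add: m_def \<sigma>_def r_def ring_distribs)
  have var: "(\<Sum>s\<in>D. pmf p s * (X s - m)\<^sup>2) = \<sigma>\<^sup>2"
    using fin D by (simp add: \<sigma>_def m_def std_dev_square expectation_pmf_sum[where D = D])
  \<comment> \<open>Centring costs nothing: \<open>P\<close> has mass 1 and \<open>X - m\<close> has
    mean 0 under \<open>p\<close>. With \<open>Q_diff\<close>, pairing \<open>P - p\<close> with
    \<open>Q - p\<close> therefore measures the gain in expectation.\<close>
  have mean: "(\<Sum>s\<in>D. (pmf P s - pmf p s) * (X s - m)) = measure_pmf.expectation P X - m"
    if "set_pmf P \<subseteq> D" for P
  proof -
    have "(\<Sum>s\<in>D. (pmf P s - pmf p s) * (X s - m))
        = (\<Sum>s\<in>D. pmf P s * X s) - (\<Sum>s\<in>D. pmf P s) * m - (\<Sum>s\<in>D. pmf p s * (X s - m))"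
      by (simp add: left_diff_distrib right_diff_distrib sum_subtractf sum_distrib_right)
    then show ?thesis
      using that fin D sum_centered_eq_0[of D p X]
      by (simp add: m_def sum_pmf_eq_1 expectation_pmf_sum[where D = D])
  qed
  have EQ: "measure_pmf.expectation Q X = m + r * \<sigma>"
  proof -
    have "measure_pmf.expectation Q X - m = (\<Sum>s\<in>D. pmf p s * (X s - m)\<^sup>2 * (r / \<sigma>))"
      unfolding mean[OF Q, symmetric]
      by (intro sum.cong) (simp_all add: Q_diff power2_eq_square ac_simps)
    also have "\<dots> = \<sigma>\<^sup>2 * (r / \<sigma>)"
      by (simp only: var flip: sum_distrib_right)
    finally show ?thesis
      by (cases "\<sigma> = 0") (simp_all add: power2_eq_square algebra_simps)
  qed
  have chi_Q: "(\<Sum>s\<in>D. (pmf Q s - pmf p s)\<^sup>2 / pmf p s) = r\<^sup>2 * (if \<sigma> = 0 then 0 else 1)"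
  proof -
    have "(\<Sum>s\<in>D. (pmf Q s - pmf p s)\<^sup>2 / pmf p s) = (\<Sum>s\<in>D. pmf p s * (X s - m)\<^sup>2 * (r / \<sigma>)\<^sup>2)"
      using pos by (intro sum.cong) (auto simp: Q_diff power2_eq_square)
    also have "\<dots> = \<sigma>\<^sup>2 * (r / \<sigma>)\<^sup>2"
      by (simp only: var flip: sum_distrib_right)
    finally show ?thesis
      by (simp add: power_divide)
  qed
  have Q_prior: "Q \<in> prior_set D p c"
    using chi_square_eq[OF fin D Q] chi_Q Q r c by (auto simp: prior_set_def split: if_splits)
  \<comment> \<open>Expand around \<open>p\<close>: the cross term is linear in the expectation of
    \<open>X\<close> under \<open>P\<close>, because \<open>(Q - p) / p\<close> is proportional to
    \<open>X - m\<close>. Each of the two squares contributes at most \<open>r^2\<close>.\<close>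
  have key: "(\<Sum>s\<in>D. (pmf P s - pmf Q s)\<^sup>2 / pmf p s)
      \<le> 2 * (r / \<sigma>) * (m + r * \<sigma> - measure_pmf.expectation P X)"
    if P: "P \<in> prior_set D p c" and "\<sigma> \<noteq> 0" for P
  proof -
    have PD: "set_pmf P \<subseteq> D"
      using P by (simp add: prior_set_def)
    have "(pmf P s - pmf Q s)\<^sup>2 / pmf p s = (pmf P s - pmf p s)\<^sup>2 / pmf p s
        - 2 * (r / \<sigma>) * ((pmf P s - pmf p s) * (X s - m)) + (pmf Q s - pmf p s)\<^sup>2 / pmf p s"
      if s: "s \<in> D" for s
    proof -
      have "(pmf P s - pmf Q s)\<^sup>2 = (pmf P s - pmf p s)\<^sup>2
          - 2 * (pmf P s - pmf p s) * (pmf Q s - pmf p s) + (pmf Q s - pmf p s)\<^sup>2"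
        by (simp add: power2_eq_square algebra_simps)
      moreover have "2 * (pmf P s - pmf p s) * (pmf Q s - pmf p s) / pmf p s
          = 2 * (r / \<sigma>) * ((pmf P s - pmf p s) * (X s - m))"
        using pos[OF s] by (simp add: Q_diff[OF s])
      ultimately show ?thesis
        by (simp add: add_divide_distrib diff_divide_distrib)
    qed
    then have "(\<Sum>s\<in>D. (pmf P s - pmf Q s)\<^sup>2 / pmf p s)
        = (\<Sum>s\<in>D. (pmf P s - pmf p s)\<^sup>2 / pmf p s)
          - 2 * (r / \<sigma>) * (measure_pmf.expectation P X - m) + r\<^sup>2"
      using \<open>\<sigma> \<noteq> 0\<close> chi_Q
      by (simp add: sum.distrib sum_subtractf sum_distrib_left sum_divide_distrib flip: mean[OF PD])
    also have "\<dots> \<le> r\<^sup>2 - 2 * (r / \<sigma>) * (measure_pmf.expectation P X - m) + r\<^sup>2"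
      using P r chi_square_eq[OF fin D PD] by (simp add: prior_set_def)
    also have "\<dots> = 2 * (r / \<sigma>) * (m + r * \<sigma> - measure_pmf.expectation P X)"
      using \<open>\<sigma> \<noteq> 0\<close> by (simp add: field_simps power2_eq_square)
    finally show ?thesis .
  qed
  have eq_Q: "P = Q"
    if P: "P \<in> prior_set D p c" and "(\<Sum>s\<in>D. (pmf P s - pmf Q s)\<^sup>2 / pmf p s) \<le> 0" for P
  proof (rule pmf_eqI)
    fix s
    have "(\<Sum>s\<in>D. (pmf P s - pmf Q s)\<^sup>2 / pmf p s) = 0"
      using that(2) by (intro antisym sum_nonneg) auto
    then have "\<forall>s\<in>D. (pmf P s - pmf Q s)\<^sup>2 / pmf p s = 0"
      using fin by (subst (asm) sum_nonneg_eq_0_iff) auto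
    moreover have "pmf P s = 0 \<and> pmf Q s = 0" if "s \<notin> D"
      using that P Q by (auto simp: prior_set_def set_pmf_iff)
    ultimately show "pmf P s = pmf Q s"
      using pos by (cases "s \<in> D") fastforce+
  qed
  have const: "X constant_on D \<longleftrightarrow> \<sigma> = 0"
    using std_dev_eq_0_iff_constant[OF fin D, of X] by (simp add: \<sigma>_def)
  have le: "measure_pmf.expectation P X \<le> measure_pmf.expectation Q X"
    if P: "P \<in> prior_set D p c" for P
  proof (cases "\<sigma> = 0")
    case True
    then obtain k where k: "\<forall>s\<in>D. X s = k"
      using const unfolding constant_on_def by blast
    have "measure_pmf.expectation R X = k" if "set_pmf R \<subseteq> D" for R
      using that fin k by (simp add: expectation_pmf_sum[where D = D] sum_pmf_eq_1 flip: sum_distrib_right)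
    then show ?thesis
      using P Q by (simp add: prior_set_def)
  next
    case False
    show ?thesis
    \<comment> \<open>For \<open>r = 0\<close> the factor \<open>2 * (r / \<sigma>)\<close> cannot
      be cancelled from \<open>key\<close>, but the right-hand side is then 0 and forces
      \<open>P = Q\<close>: the ball is a single point.\<close>
    proof (cases "r = 0")
      case True
      then have "P = Q"
        using key[OF P False] by (intro eq_Q[OF P]) simp
      then show ?thesis
        by simp
    next
      case r0: False
      have "0 \<le> (\<Sum>s\<in>D. (pmf P s - pmf Q s)\<^sup>2 / pmf p s)"
        by (intro sum_nonneg) auto
      then have "0 \<le> 2 * (r / \<sigma>) * (m + r * \<sigma> - measure_pmf.expectation P X)"
        using key[OF P False] by linarith
      moreover have "2 * (r / \<sigma>) > 0"
        using r \<sigma> r0 False by simp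
      ultimately show ?thesis
        by (simp only: EQ zero_le_mult_iff) linarith
    qed
  qed
  have Q_eq_p: "Q = p" if "\<sigma> = 0"
  proof (rule pmf_eqI)
    show "pmf Q s = pmf p s" for s
      using that Q_diff[of s] Q D by (cases "s \<in> D") (auto simp: set_pmf_iff)
  qed
  have "P = Q" if "is_maximizing_prior D p c X P" for P
  \<comment> \<open>For \<open>\<sigma> = 0\<close> uniqueness comes from the convention, as every
    prior is optimal. Otherwise a maximizer attains \<open>m + r * \<sigma>\<close>, so the
    right-hand side of \<open>key\<close> vanishes.\<close>
  proof (cases "\<sigma> = 0")
    case True
    then show ?thesis
      using that Q_eq_p const by (simp add: is_maximizing_prior_def)
  next
    case False
    have P: "P \<in> prior_set D p c" and "\<not> measure_pmf.expectation P X < measure_pmf.expectation Q X"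
      using that Q_prior by (auto simp: is_maximizing_prior_def is_arg_max_def)
    then have "measure_pmf.expectation P X = m + r * \<sigma>"
      using le[OF P] EQ by simp
    then show ?thesis
      using key[OF P False] by (intro eq_Q[OF P]) simp
  qed
  moreover have "is_maximizing_prior D p c X Q"
    using Q_prior Q_eq_p le const
    by (auto simp: is_maximizing_prior_def is_arg_max_def not_less)
  ultimately have "is_maximizing_prior D p c X P \<longleftrightarrow> P = Q" for P
    by blast
  then show ?thesis
    using that[OF Q_prior Qs EQ[unfolded m_def r_def \<sigma>_def] le] by blast
qed

section \<open>Minimization by sign change, and the value\<close>

text \<open>Negation reverses the order of expectations, and the convention carries over because
  \<open>X\<close> and \<open>-X\<close> are constant together.\<close>

lemma is_minimizing_prior_iff_maximizing_uminus:
  "is_minimizing_prior D p c X P \<longleftrightarrow> is_maximizing_prior D p c (\<lambda>s. - X s) P"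
proof -
  have "X constant_on D \<longleftrightarrow> (\<lambda>s. - X s) constant_on D"
    unfolding constant_on_def by (metis minus_minus)
  then show ?thesis
    by (simp add: is_minimizing_prior_def is_maximizing_prior_def is_arg_min_def is_arg_max_def)
qed

theorem proposition2p2:
  fixes D :: "'s set" and p0 :: "'s pmf" and c \<alpha> :: real
    and I :: "real set" and u :: "real \<Rightarrow> real" and W :: "'s \<Rightarrow> real"
  assumes "finite D" and "card D \<ge> 2"
    and "set_pmf p0 = D"
    and "1 \<le> c" and "c < Min ((\<lambda>s. 1 / (1 - pmf p0 s)) ` D)"
    and "strictly_concave_on I u"
    and "\<forall>s\<in>D. W s \<in> I"
    and "0 \<le> \<alpha>" and "\<alpha> \<le> 1"
  shows "(\<exists>!P. is_minimizing_prior D p0 c (\<lambda>s. u (W s)) P) \<and>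
    (\<exists>!P. is_maximizing_prior D p0 c (\<lambda>s. u (W s)) P) \<and>
    (\<forall>P. is_minimizing_prior D p0 c (\<lambda>s. u (W s)) P \<longrightarrow>
      (\<forall>s\<in>D. pmf P s = pmf p0 s *
        (1 + (measure_pmf.expectation p0 (\<lambda>t. u (W t)) - u (W s)) /
               std_dev p0 (\<lambda>t. u (W t)) * sqrt (c - 1)))) \<and>
    (\<forall>P. is_maximizing_prior D p0 c (\<lambda>s. u (W s)) P \<longrightarrow>
      (\<forall>s\<in>D. pmf P s = pmf p0 s *
        (1 - (measure_pmf.expectation p0 (\<lambda>t. u (W t)) - u (W s)) /
               std_dev p0 (\<lambda>t. u (W t)) * sqrt (c - 1)))) \<and>
    alpha_MEU D p0 c u \<alpha> W =
      measure_pmf.expectation p0 (\<lambda>s. u (W s)) -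
      sqrt (c - 1) * (2 * \<alpha> - 1) * std_dev p0 (\<lambda>s. u (W s))"
proof -
  define X where "X = (\<lambda>s. u (W s))"
  have bound: "pmf p0 s < 1 \<and> c \<le> 1 / (1 - pmf p0 s)" if s: "s \<in> D" for s
  proof
    show "c \<le> 1 / (1 - pmf p0 s)"
      using assms(1,5) s by (subst (asm) Min_gr_iff) (auto intro: less_imp_le)
    \<comment> \<open>If \<open>pmf p0 s = 1\<close>, the bound on \<open>c\<close> reads \<open>c < 1 / 0 = 0\<close>.\<close>
    then have "pmf p0 s \<noteq> 1"
      using assms(4) by auto
    then show "pmf p0 s < 1"
      using pmf_le_1[of p0 s] by linarith
  qed
  obtain Q where Q: "Q \<in> prior_set D p0 c"
    and Qs: "\<And>s. s \<in> D \<Longrightarrow> pmf Q s = pmf p0 s *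
      (1 + (X s - measure_pmf.expectation p0 X) / std_dev p0 X * sqrt (c - 1))"
    and EQ: "measure_pmf.expectation Q X = measure_pmf.expectation p0 X + sqrt (c - 1) * std_dev p0 X"
    and Q_max: "\<And>P. P \<in> prior_set D p0 c \<Longrightarrow>
      measure_pmf.expectation P X \<le> measure_pmf.expectation Q X"
    and Q_iff: "\<And>P. is_maximizing_prior D p0 c X P \<longleftrightarrow> P = Q"
    using ex_optimal_prior[OF assms(1,3,4) bound, of X] by blast
  obtain R where R: "R \<in> prior_set D p0 c"
    and Rs: "\<And>s. s \<in> D \<Longrightarrow> pmf R s = pmf p0 s *
      (1 + (- X s - measure_pmf.expectation p0 (\<lambda>s. - X s)) / std_dev p0 (\<lambda>s. - X s) * sqrt (c - 1))"
    and ER: "measure_pmf.expectation R (\<lambda>s. - X s) =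
      measure_pmf.expectation p0 (\<lambda>s. - X s) + sqrt (c - 1) * std_dev p0 (\<lambda>s. - X s)"
    and R_max: "\<And>P. P \<in> prior_set D p0 c \<Longrightarrow>
      measure_pmf.expectation P (\<lambda>s. - X s) \<le> measure_pmf.expectation R (\<lambda>s. - X s)"
    and R_iff: "\<And>P. is_maximizing_prior D p0 c (\<lambda>s. - X s) P \<longleftrightarrow> P = R"
    using ex_optimal_prior[OF assms(1,3,4) bound, of "\<lambda>s. - X s"] by blast
  \<comment> \<open>The supremum is attained at \<open>Q\<close>, and below the infimum at
    \<open>R\<close>, so both are genuine extreme values.\<close>
  have sup: "(SUP P\<in>prior_set D p0 c. measure_pmf.expectation P X)
      = measure_pmf.expectation p0 X + sqrt (c - 1) * std_dev p0 X"
    unfolding EQ[symmetric] using Q Q_max by (intro cSup_eq_maximum) auto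
  have ER': "measure_pmf.expectation R X = measure_pmf.expectation p0 X - sqrt (c - 1) * std_dev p0 X"
    using ER by (simp add: std_dev_uminus)
  have inf: "(INF P\<in>prior_set D p0 c. measure_pmf.expectation P X)
      = measure_pmf.expectation p0 X - sqrt (c - 1) * std_dev p0 X"
    unfolding ER'[symmetric] using R R_max by (intro cInf_eq_minimum) auto
  have R_weights: "pmf R s = pmf p0 s *
      (1 + (measure_pmf.expectation p0 X - X s) / std_dev p0 X * sqrt (c - 1))" if "s \<in> D" for s
    using Rs[OF that] by (simp add: std_dev_uminus)
  have Q_weights: "pmf Q s = pmf p0 s *
      (1 - (measure_pmf.expectation p0 X - X s) / std_dev p0 X * sqrt (c - 1))" if "s \<in> D" for s
    using Qs[OF that] by (simp add: diff_divide_distrib algebra_simps)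
  have "alpha_MEU D p0 c u \<alpha> W =
      measure_pmf.expectation p0 X - sqrt (c - 1) * (2 * \<alpha> - 1) * std_dev p0 X"
    unfolding alpha_MEU_def X_def[symmetric] inf sup by (simp add: algebra_simps)
  then show ?thesis
    unfolding is_minimizing_prior_iff_maximizing_uminus
    using Q_iff R_iff Q_weights R_weights unfolding X_def by simp
qed

end
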